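(* Let $\mathcal{H}_1,\mathcal{H}_2$ be Hilbert spaces over $\mathbb{F}=\mathbb{R}$ or $\mathbb{F}=\mathbb{C}$, let $K$ be a positive integer, and let $\{A_k\}_{k=1}^{K}\subset \mathcal{BC}(\mathcal{H}_1,\mathcal{H}_2)$. Assume that $\mathrm{R}(A_k)\subseteq \mathrm{N}(A_{k'}^{*})$ and $\mathrm{R}(A_k^{*})\subseteq \mathrm{N}(A_{k'})$ for each $k,k'=1,\ldots,K$, $k\neq k'$. Let $k_0\in\{1,\ldots,K\}$. If $\sum_{k=1}^{K}A_k$ is injective, then $\sum_{k=1}^{K}A_k^{*}A_k$ is invertible and $A_{k_0}^{\dagger}$ is the unique solution $X$ of the operator equation $\left(\sum_{k=1}^{K}A_k^{*}A_k\right)X=A_{k_0}^{*}$.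
   Context: $\mathcal{BC}(\mathcal{H}_1,\mathcal{H}_2)$ is the set of bounded linear operators from $\mathcal{H}_1$ to $\mathcal{H}_2$ with closed range. $A^{*}$, $\mathrm{N}(A)$, $\mathrm{R}(A)$ denote the adjoint, null space and range of $A$. For $A\in\mathcal{BC}(\mathcal{H}_1,\mathcal{H}_2)$, the Moore--Penrose inverse $A^{\dagger}\in\mathcal{BC}(\mathcal{H}_2,\mathcal{H}_1)$ is the unique solution $X$ of $AXA=A$, $XAX=X$, $(AX)^{*}=AX$, $(XA)^{*}=XA$. *)

theory Defs
  imports "HOL-Analysis.Analysis"
begin

text \<open>The scalar fields \<open>\<real>\<close> and \<open>\<complex>\<close>, treated uniformly. The axioms leave no other field:
  in the second alternative of \<open>real_or_complex\<close>, additivity and \<open>mult_conjugate\<close> force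
  \<open>conjugate (a + b i) = a - b i\<close> and \<open>norm (a + b i) = sqrt (a\<^sup>2 + b\<^sup>2)\<close>.\<close>

class real_or_complex_field = real_normed_field +
  fixes conjugate :: "'a \<Rightarrow> 'a"
  assumes conjugate_add: "conjugate (x + y) = conjugate x + conjugate y"
    and conjugate_mult: "conjugate (x * y) = conjugate x * conjugate y"
    and conjugate_conjugate: "conjugate (conjugate x) = x"
    and mult_conjugate: "x * conjugate x = (norm x)\<^sup>2 *\<^sub>R 1"
    and real_or_complex: "(\<forall>x. \<exists>a. x = a *\<^sub>R 1) \<or>
      (\<exists>i. i * i = - 1 \<and> (\<forall>x. \<exists>a b. x = a *\<^sub>R 1 + b *\<^sub>R i))"

instantiation real :: real_or_complex_field
begin
definition conjugate_real :: "real \<Rightarrow> real" where "conjugate_real x = x"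
instance by standard (auto simp: conjugate_real_def power2_eq_square)
end

instantiation complex :: real_or_complex_field
begin
definition conjugate_complex :: "complex \<Rightarrow> complex" where "conjugate_complex = cnj"
instance
proof
  show "(\<forall>x::complex. \<exists>a. x = a *\<^sub>R 1) \<or>
      (\<exists>i::complex. i * i = - 1 \<and> (\<forall>x. \<exists>a b. x = a *\<^sub>R 1 + b *\<^sub>R i))"
    by (intro disjI2 exI[of _ \<i>]) (metis complex_eq i_squared mult.commute mult.right_neutral scaleR_conv_of_real)
qed (simp_all add: conjugate_complex_def complex_norm_square[symmetric] scaleR_conv_of_real del: of_real_power)
end

text \<open>A Hilbert space over the scalar field is a whole type. Its norm, metric and completeness come
  from \<^class>\<open>banach\<close>; \<open>ip_self\<close> says that this norm is the one induced by the inner product,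
  which is linear in the first argument.\<close>

locale hilbert_space = vector_space scale
  for scale :: "'f::real_or_complex_field \<Rightarrow> 'a::banach \<Rightarrow> 'a" +
  fixes ip :: "'a \<Rightarrow> 'a \<Rightarrow> 'f"
  assumes scale_of_real: "scale (of_real r) x = r *\<^sub>R x"
    and ip_add_left: "ip (x + y) z = ip x z + ip y z"
    and ip_scale_left: "ip (scale c x) y = c * ip x y"
    and ip_commute: "ip y x = conjugate (ip x y)"
    and ip_self: "ip x x = of_real ((norm x)\<^sup>2)"

lemma hilbert_space_real:
  "hilbert_space (*\<^sub>R) (inner :: 'a::{real_inner,banach} \<Rightarrow> 'a \<Rightarrow> real)"
  by unfold_locales
    (auto simp: conjugate_real_def inner_add_left inner_add_right inner_commute power2_norm_eq_inner
      scaleR_add_left scaleR_add_right)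

lemma hilbert_space_complex:
  "hilbert_space (*) (\<lambda>x y :: complex. x * cnj y)"
  by unfold_locales
    (auto simp: conjugate_complex_def algebra_simps scaleR_conv_of_real
      complex_norm_square[symmetric] simp del: of_real_power)

definition null_space :: "('a \<Rightarrow> 'b::zero) \<Rightarrow> 'a set" where
  "null_space A = {x. A x = 0}"

definition bounded_operators ::
  "('f::field \<Rightarrow> 'a::banach \<Rightarrow> 'a) \<Rightarrow> ('f \<Rightarrow> 'b::banach \<Rightarrow> 'b) \<Rightarrow> ('a \<Rightarrow> 'b) set" where
  "bounded_operators s1 s2 =
     {A. Vector_Spaces.linear s1 s2 A \<and> (\<exists>C. \<forall>x. norm (A x) \<le> C * norm x)}"

definition closed_range_operators ::
  "('f::field \<Rightarrow> 'a::banach \<Rightarrow> 'a) \<Rightarrow> ('f \<Rightarrow> 'b::banach \<Rightarrow> 'b) \<Rightarrow> ('a \<Rightarrow> 'b) set" where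
  "closed_range_operators s1 s2 = {A \<in> bounded_operators s1 s2. closed (range A)}"

definition invertible_operator :: "('f::field \<Rightarrow> 'a::banach \<Rightarrow> 'a) \<Rightarrow> ('a \<Rightarrow> 'a) \<Rightarrow> bool" where
  "invertible_operator s S \<longleftrightarrow>
     S \<in> bounded_operators s s \<and> (\<exists>T \<in> bounded_operators s s. T \<circ> S = id \<and> S \<circ> T = id)"

definition adjoint_op ::
  "('a \<Rightarrow> 'a \<Rightarrow> 'f) \<Rightarrow> ('b \<Rightarrow> 'b \<Rightarrow> 'f) \<Rightarrow> ('a \<Rightarrow> 'b) \<Rightarrow> ('b \<Rightarrow> 'a)" where
  "adjoint_op ip1 ip2 A = (THE B. \<forall>x y. ip2 (A x) y = ip1 x (B y))"

definition moore_penrose ::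
  "('f::field \<Rightarrow> 'a::banach \<Rightarrow> 'a) \<Rightarrow> ('a \<Rightarrow> 'a \<Rightarrow> 'f) \<Rightarrow>
   ('f \<Rightarrow> 'b::banach \<Rightarrow> 'b) \<Rightarrow> ('b \<Rightarrow> 'b \<Rightarrow> 'f) \<Rightarrow> ('a \<Rightarrow> 'b) \<Rightarrow> ('b \<Rightarrow> 'a)" where
  "moore_penrose s1 ip1 s2 ip2 A = (THE X. X \<in> closed_range_operators s2 s1 \<and>
     A \<circ> X \<circ> A = A \<and> X \<circ> A \<circ> X = X \<and>
     adjoint_op ip2 ip2 (A \<circ> X) = A \<circ> X \<and> adjoint_op ip1 ip1 (X \<circ> A) = X \<circ> A)"

end

theory Submission
  imports Defs
begin

text \<open>For an operator \<open>A\<close> with closed range, uniform boundedness makes \<open>A\<^sup>*\<close> bounded below on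
  the range of \<open>A\<close>; hence the range of \<open>A\<^sup>*\<close> is closed, \<open>A\<close> is bounded below on it, and
  \<open>A\<^sup>\<dagger> y\<close> is the unique \<open>u\<close> in the range of \<open>A\<^sup>*\<close> for which \<open>A u\<close> is the orthogonal
  projection of \<open>y\<close> onto the range of \<open>A\<close>. Under the orthogonality hypotheses
  \<open>A\<^sub>j A\<^sub>k\<^sup>\<dagger> = 0\<close> for \<open>j \<noteq> k\<close>, so \<open>\<Sum> A\<^sub>j\<close> kills \<open>x - \<Sum> A\<^sub>k\<^sup>\<dagger> A\<^sub>k x\<close>, and injectivity gives
  \<open>\<Sum> A\<^sub>k\<^sup>\<dagger> A\<^sub>k = 1\<close>. Then \<open>\<Sum> A\<^sub>k\<^sup>\<dagger> (A\<^sub>k\<^sup>\<dagger>)\<^sup>*\<close> is the inverse of \<open>\<Sum> A\<^sub>k\<^sup>* A\<^sub>k\<close>.\<close>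

subsection \<open>Hilbert spaces over the real or complex field\<close>

lemma additive_conjugate: "Modules.additive (conjugate :: 'f::real_or_complex_field \<Rightarrow> 'f)"
  by standard (rule conjugate_add)

lemmas conjugate_zero = Modules.additive.zero[OF additive_conjugate]

text \<open>\<open>mult_conjugate\<close> at \<open>x\<close> and at \<open>conjugate x\<close>
  evaluates the same product twice.\<close>

lemma norm_conjugate: "norm (conjugate x) = norm (x :: 'f::real_or_complex_field)"
proof -
  have "(norm (conjugate x))\<^sup>2 *\<^sub>R (1::'f) = (norm x)\<^sup>2 *\<^sub>R 1"
    using mult_conjugate[of x] mult_conjugate[of "conjugate x"] by (simp add: conjugate_conjugate mult.commute)
  then show ?thesis
    by simp
qed

context hilbert_space
begin

section \<open>Sesquilinearity, norm identities and the Cauchy-Schwarz inequality\<close>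

lemma ip_add_right: "ip x (y + z) = ip x y + ip x z"
  by (metis ip_commute ip_add_left conjugate_add)

lemma ip_scale_right: "ip x (scale c y) = conjugate c * ip x y"
  by (metis ip_commute ip_scale_left conjugate_mult)

lemma additive_ip_left: "Modules.additive (\<lambda>x. ip x y)"
  by standard (rule ip_add_left)

lemma additive_ip_right: "Modules.additive (\<lambda>y. ip x y)"
  by standard (rule ip_add_right)

lemmas ip_zero_left [simp] = Modules.additive.zero[OF additive_ip_left]
  and ip_zero_right [simp] = Modules.additive.zero[OF additive_ip_right]
  and ip_diff_left = Modules.additive.diff[OF additive_ip_left]
  and ip_diff_right = Modules.additive.diff[OF additive_ip_right]
  and ip_sum_left = Modules.additive.sum[OF additive_ip_left]

lemma ip_eq_zero_commute: "ip x y = 0 \<longleftrightarrow> ip y x = 0"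
  by (metis ip_commute conjugate_zero)

lemma norm_ip_self: "norm (ip x x) = (norm x)\<^sup>2"
  by (simp add: ip_self norm_power)

lemma ip_self_eq_zero [simp]: "ip x x = 0 \<longleftrightarrow> x = 0"
  by (simp add: ip_self)

lemma ip_left_eqI: "x = y" if "\<And>z. ip x z = ip y z"
  using that[of "x - y"] by (metis ip_diff_left ip_self_eq_zero right_minus_eq)

lemma ip_right_eqI: "x = y" if "\<And>z. ip z x = ip z y"
  using that by (metis ip_commute ip_left_eqI)

text \<open>The norm of \<open>banach\<close> is homogeneous for real scalars; for \<open>c\<close>
  in \<open>'f\<close> this comes from expanding \<open>ip (scale c x) (scale c x)\<close>.\<close>

lemma norm_scale: "norm (scale c x) = norm c * norm x"
proof -
  have "(norm (scale c x))\<^sup>2 = (norm c * norm x)\<^sup>2"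
    unfolding norm_ip_self[symmetric] power_mult_distrib
    by (simp add: ip_scale_left ip_scale_right norm_mult norm_conjugate norm_ip_self power2_eq_square)
  then show ?thesis
    by (simp add: power2_eq_iff_nonneg)
qed

lemma pythagoras:
  assumes "ip x y = 0"
  shows "(norm (x + y))\<^sup>2 = (norm x)\<^sup>2 + (norm y)\<^sup>2"
proof -
  \<comment> \<open>The identity is proved in \<open>'f\<close> and pulled back to the reals by
    injectivity of \<open>of_real\<close>.\<close>
  have "(of_real ((norm (x + y))\<^sup>2) :: 'f) = of_real ((norm x)\<^sup>2 + (norm y)\<^sup>2)"
    using assms ip_eq_zero_commute[of x y]
    by (simp add: ip_self[symmetric] ip_add_left ip_add_right del: of_real_power)
  then show ?thesis
    by (simp only: of_real_eq_iff)
qed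

lemma parallelogram:
  fixes x y :: 'a
  shows "(norm (x + y))\<^sup>2 + (norm (x - y))\<^sup>2 = 2 * (norm x)\<^sup>2 + 2 * (norm y)\<^sup>2"
proof -
  have "(of_real ((norm (x + y))\<^sup>2 + (norm (x - y))\<^sup>2) :: 'f) = of_real (2 * (norm x)\<^sup>2 + 2 * (norm y)\<^sup>2)"
    unfolding of_real_add of_real_mult ip_self[symmetric]
    by (simp add: ip_add_left ip_add_right ip_diff_left ip_diff_right)
  then show ?thesis
    by (simp only: of_real_eq_iff)
qed

lemma orthogonal_component:
  assumes "m \<noteq> 0"
  shows "ip (u - scale (ip u m / ip m m) m) m = 0"
  using assms by (simp add: ip_diff_left ip_scale_left)

text \<open>By Pythagoras, the component \<open>scale c m\<close> of \<open>u\<close> along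
  \<open>m\<close> is no longer than \<open>u\<close>.\<close>

lemma Cauchy_Schwarz: "norm (ip u m) \<le> norm u * norm m"
proof (cases "m = 0")
  case False
  define c where "c = ip u m / ip m m"
  have "ip (u - scale c m) (scale c m) = 0"
    using orthogonal_component[OF False, of u] by (simp add: c_def ip_scale_right)
  from pythagoras[OF this] have "(norm c * norm m)\<^sup>2 \<le> (norm u)\<^sup>2"
    by (simp add: norm_scale)
  then have "norm c * norm m \<le> norm u"
    by (simp add: abs_le_square_iff[symmetric])
  then show ?thesis
    using False by (simp add: c_def norm_divide norm_ip_self field_simps power2_eq_square)
qed simp

section \<open>Orthogonal projection and Riesz representation\<close>

text \<open>A sequence in \<open>R\<close> minimising the distance to \<open>x\<close> is Cauchy by
  the parallelogram law; its limit is the projection.\<close>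

lemma orthogonal_projection_exists:
  assumes "subspace R" and "closed R"
  shows "\<exists>p\<in>R. \<forall>m\<in>R. ip (x - p) m = 0"
proof -
  define d where "d = infdist x R"
  have R0: "R \<noteq> {}"
    using subspace_0[OF assms(1)] by blast
  have d0: "d \<ge> 0"
    by (simp add: d_def infdist_nonneg)
  have d_le: "d \<le> norm (x - m)" if "m \<in> R" for m
    using infdist_le[OF that, of x] by (simp add: d_def dist_norm)
  have "\<exists>p\<in>R. norm (x - p) < d + inverse (real (Suc n))" for n
  proof -
    have "(INF a\<in>R. dist x a) < d + inverse (real (Suc n))"
      using infdist_notempty[OF R0, of x] by (simp add: d_def)
    then show ?thesis
      using R0 by (subst (asm) cINF_less_iff) (auto simp: dist_norm intro: bdd_belowI2[of _ 0])
  qed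
  then obtain p where pR: "\<And>n. p n \<in> R" and p_less: "\<And>n. norm (x - p n) < d + inverse (real (Suc n))"
    by metis
  have dist_lim: "(\<lambda>n. norm (x - p n)) \<longlonglongrightarrow> d"
  proof (rule tendsto_sandwich[where f = "\<lambda>_. d" and h = "\<lambda>n. d + inverse (real (Suc n))"])
    show "(\<lambda>n. d + inverse (real (Suc n))) \<longlonglongrightarrow> d"
      using tendsto_add[OF tendsto_const LIMSEQ_inverse_real_of_nat] by simp
    show "\<forall>\<^sub>F n in sequentially. d \<le> norm (x - p n)"
      by (intro eventuallyI d_le pR)
    show "\<forall>\<^sub>F n in sequentially. norm (x - p n) \<le> d + inverse (real (Suc n))"
      by (intro eventuallyI less_imp_le p_less)
  qed simp
  \<comment> \<open>Midpoints stay in \<open>R\<close>, hence at distance at least \<open>d\<close>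
    from \<open>x\<close>. They are written with \<open>scale\<close> because
    \<open>subspace\<close> refers to it.\<close>
  have half: "scale (of_real (1/2)) (p m + p n) \<in> R" for m n
    using assms(1) pR by (intro subspace_scale subspace_add)
  have near: "(norm (p m - p n))\<^sup>2 \<le> 2 * (norm (x - p m))\<^sup>2 + 2 * (norm (x - p n))\<^sup>2 - 4 * d\<^sup>2" for m n
  proof -
    have "(x - p n) + (x - p m) = 2 *\<^sub>R (x - scale (of_real (1/2)) (p m + p n))"
      unfolding scale_of_real by (simp add: algebra_simps scaleR_2)
    then have "norm ((x - p n) + (x - p m)) = 2 * norm (x - scale (of_real (1/2)) (p m + p n))"
      by simp
    then have "2 * d \<le> norm ((x - p n) + (x - p m))"
      using d_le[OF half[of m n]] by linarith
    then have "4 * d\<^sup>2 \<le> (norm ((x - p n) + (x - p m)))\<^sup>2"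
      using power_mono[of "2 * d" _ 2] d0 by (simp add: power_mult_distrib)
    then show ?thesis
      using parallelogram[of "x - p n" "x - p m"] by (simp add: algebra_simps)
  qed
  have "Cauchy p"
  proof (rule metric_CauchyI)
    fix e :: real assume "e > 0"
    have "(\<lambda>n. (norm (x - p n))\<^sup>2) \<longlonglongrightarrow> d\<^sup>2"
      by (intro tendsto_power dist_lim)
    \<comment> \<open>A slack of \<open>e\<^sup>2 / 4\<close> in each of the two terms of
      \<open>near\<close> adds up to \<open>e\<^sup>2\<close>.\<close>
    then have "\<forall>\<^sub>F n in sequentially. (norm (x - p n))\<^sup>2 < d\<^sup>2 + e\<^sup>2 / 4"
      by (rule order_tendstoD) (use \<open>e > 0\<close> in simp)
    then obtain N where N: "\<And>n. n \<ge> N \<Longrightarrow> (norm (x - p n))\<^sup>2 < d\<^sup>2 + e\<^sup>2 / 4"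
      by (auto simp: eventually_sequentially)
    have "dist (p m) (p n) < e" if "m \<ge> N" "n \<ge> N" for m n
    proof -
      have "(norm (p m - p n))\<^sup>2 < e\<^sup>2"
        using near[of m n] N[OF that(1)] N[OF that(2)] by linarith
      then show ?thesis
        using \<open>e > 0\<close> by (simp add: dist_norm power2_less_imp_less)
    qed
    then show "\<exists>N. \<forall>m\<ge>N. \<forall>n\<ge>N. dist (p m) (p n) < e"
      by blast
  qed
  then obtain q where q: "p \<longlonglongrightarrow> q"
    by (auto simp: Cauchy_convergent_iff convergent_def)
  have qR: "q \<in> R"
    using closed_sequentially[OF assms(2) _ q] pR by blast
  have "(\<lambda>n. norm (x - p n)) \<longlonglongrightarrow> norm (x - q)"
    by (intro tendsto_intros q)
  then have norm_q: "norm (x - q) = d"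
    using dist_lim LIMSEQ_unique by blast
  have "ip (x - q) m = 0" if "m \<in> R" for m
  proof (cases "m = 0")
    case False
    \<comment> \<open>If the component of \<open>x - q\<close> along \<open>m\<close> were nonzero,
      moving \<open>q\<close> by it inside \<open>R\<close> would bring the distance to
      \<open>x\<close> below \<open>d\<close>.\<close>
    define c where "c = ip (x - q) m / ip m m"
    have orth: "ip (x - q - scale c m) m = 0"
      unfolding c_def by (rule orthogonal_component[OF False])
    then have "ip (x - q - scale c m) (scale c m) = 0"
      by (simp add: ip_scale_right)
    from pythagoras[OF this] have "(norm (x - q))\<^sup>2 = (norm (x - (q + scale c m)))\<^sup>2 + (norm (scale c m))\<^sup>2"
      by (simp add: algebra_simps)
    moreover have "d \<le> norm (x - (q + scale c m))"
      using assms(1) qR that by (intro d_le subspace_add subspace_scale)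
    then have "d\<^sup>2 \<le> (norm (x - (q + scale c m)))\<^sup>2"
      using d0 by (intro power_mono)
    ultimately have c0: "scale c m = 0"
      using norm_q by simp
    show ?thesis
      using orth unfolding c0 by simp
  qed simp
  then show ?thesis
    using qR by blast
qed

text \<open>If \<open>f\<close> is nonzero, some \<open>u\<close> orthogonal to its closed kernel
  has \<open>f u = 1\<close>. Since \<open>x - scale (f x) u\<close> lies in the kernel,
  \<open>ip x u = f x * ip u u\<close>.\<close>

lemma riesz_representation:
  assumes add: "\<And>x y. f (x + y) = f x + f y" and scale: "\<And>c x. f (scale c x) = c * f x"
    and bound: "\<And>x. norm (f x) \<le> C * norm x"
  shows "\<exists>w. \<forall>x. f x = ip x w"
proof (cases "\<forall>x. f x = 0")
  case True
  then show ?thesis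
    by (intro exI[of _ 0]) simp
next
  case False
  then obtain v where v: "f v \<noteq> 0"
    by blast
  interpret f: Modules.additive f
    by standard (rule add)
  have f_R: "f (r *\<^sub>R x) = r *\<^sub>R f x" for r x
    using scale[of "of_real r" x] by (simp add: scale_of_real scaleR_conv_of_real)
  have "bounded_linear f"
    by (rule bounded_linear_intro[where K = C, OF add f_R]) (use bound in \<open>simp add: mult.commute\<close>)
  then have "closed {x. f x = 0}"
    by (intro closed_Collect_eq linear_continuous_on continuous_on_const)
  moreover have "subspace {x. f x = 0}"
    by (rule subspaceI) (simp_all add: add scale f.zero)
  ultimately obtain p where p: "f p = 0" and orth: "\<And>m. f m = 0 \<Longrightarrow> ip (v - p) m = 0"
    using orthogonal_projection_exists[of "{x. f x = 0}" v] unfolding mem_Collect_eq Bex_def Ball_def by metis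
  define u where "u = scale (inverse (f v)) (v - p)"
  have fu: "f u = 1"
    using v p by (simp add: u_def scale f.diff)
  have "u \<noteq> 0"
    using fu f.zero by auto
  \<comment> \<open>The factor is conjugated because \<open>ip\<close> is conjugate-linear in its
    second argument.\<close>
  have "f x = ip x (scale (conjugate (inverse (ip u u))) u)" for x
  proof -
    have "f (x - scale (f x) u) = 0"
      by (simp add: f.diff scale fu)
    from orth[OF this] have "ip u (x - scale (f x) u) = 0"
      unfolding u_def ip_scale_left by simp
    then have "ip (x - scale (f x) u) u = 0"
      using ip_eq_zero_commute by blast
    then have "ip x u = f x * ip u u"
      by (simp only: ip_diff_left ip_scale_left right_minus_eq)
    then show ?thesis
      using \<open>u \<noteq> 0\<close> by (simp only: ip_scale_right conjugate_conjugate) simp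
  qed
  then show ?thesis
    by blast
qed

text \<open>The uniform boundedness principle by a gliding hump instead of Baire's theorem: moving by
  \<open>(1/3)\<^sup>n\<close> along \<open>\<plusminus> w\<^sub>n\<close>, with \<open>norm w\<^sub>n > 4\<^sup>n\<close>, yields a limit \<open>L\<close> with
  \<open>norm (ip L w\<^sub>n) \<ge> (4/3)\<^sup>n / 2\<close>.\<close>

lemma weakly_bounded_imp_bounded:
  assumes "\<And>y. \<exists>B. \<forall>w\<in>W. norm (ip y w) \<le> B"
  shows "\<exists>C. \<forall>w\<in>W. norm w \<le> C"
proof (rule ccontr)
  assume "\<not> ?thesis"
  then have "\<exists>w\<in>W. norm w > 4 ^ n" for n :: nat
    by (meson not_le)
  then obtain w where wW: "\<And>n. w n \<in> W" and w_large: "\<And>n. norm (w n) > 4 ^ n"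
    by metis
  \<comment> \<open>The inner products of \<open>x + h\<close> and \<open>x - h\<close> with
    \<open>w n\<close> differ by \<open>2 * ip h (w n)\<close>, so one of them is at least as large
    in norm as \<open>ip h (w n)\<close>.\<close>
  have step: "\<exists>x'. norm (x' - x) \<le> (1/3)^n \<and> (1/3)^n * norm (w n) \<le> norm (ip x' (w n))" for x n
  proof -
    define h where "h = ((1/3)^n / norm (w n)) *\<^sub>R w n"
    have wn: "norm (w n) > 0"
      using w_large[of n] by (smt (verit) zero_le_power)
    have norm_h: "norm h = (1/3)^n"
      using wn by (simp add: h_def)
    have "ip h (w n) = of_real ((1/3)^n / norm (w n)) * ip (w n) (w n)"
      by (simp only: h_def scale_of_real[symmetric] ip_scale_left)
    then have ip_h: "norm (ip h (w n)) = (1/3)^n * norm (w n)"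
      using wn by (simp add: norm_mult norm_ip_self norm_divide norm_power power2_eq_square)
    have "2 * norm (ip h (w n)) = norm (2 * ip h (w n))"
      by (simp add: norm_mult)
    also have "\<dots> = norm (ip (x + h) (w n) - ip (x - h) (w n))"
      by (simp add: ip_add_left ip_diff_left)
    also have "\<dots> \<le> norm (ip (x + h) (w n)) + norm (ip (x - h) (w n))"
      by (rule norm_triangle_ineq4)
    finally have "norm (ip h (w n)) \<le> norm (ip (x + h) (w n)) \<or> norm (ip h (w n)) \<le> norm (ip (x - h) (w n))"
      by linarith
    then show ?thesis
      using norm_h ip_h by (auto intro: exI[of _ "x + h"] exI[of _ "x - h"])
  qed
  obtain x where x_step: "\<And>n. norm (x (Suc n) - x n) \<le> (1/3)^n"
    and x_large: "\<And>n. (1/3)^n * norm (w n) \<le> norm (ip (x (Suc n)) (w n))"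
    using dependent_nat_choice[of "\<lambda>_ _. True"
        "\<lambda>n x x'. norm (x' - x) \<le> (1/3)^n \<and> (1/3)^n * norm (w n) \<le> norm (ip x' (w n))"] step
    by auto
  \<comment> \<open>The right-hand side is the exact partial sum of the geometric series, which lets
    the induction close.\<close>
  have tail: "norm (x (n + k) - x n) \<le> 3/2 * (1/3)^n - 3/2 * (1/3)^(n + k)" for n k
  proof (induction k)
    case (Suc k)
    have "norm (x (n + Suc k) - x n) \<le> norm (x (Suc (n + k)) - x (n + k)) + norm (x (n + k) - x n)"
      using norm_triangle_ineq[of "x (Suc (n + k)) - x (n + k)" "x (n + k) - x n"] by simp
    then show ?case
      using Suc x_step[of "n + k"] by simp
  qed simp
  have tail': "norm (x m - x n) \<le> 3/2 * (1/3)^n" if "n \<le> m" for n m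
  proof -
    have "norm (x m - x n) \<le> 3/2 * (1/3)^n - 3/2 * (1/3)^m"
      using tail[of n "m - n"] that by simp
    moreover have "(0::real) \<le> (1/3)^m"
      by simp
    ultimately show ?thesis
      by linarith
  qed
  have "Cauchy x"
  proof (rule CauchyI')
    fix e :: real assume "e > 0"
    then obtain N where N: "(1/3::real)^N < 2/3 * e"
      using real_arch_pow_inv[of "2/3 * e" "1/3"] by auto
    have "dist (x m) (x n) < e" if "m \<ge> N" "n > m" for m n
    proof -
      have "(1/3::real)^m \<le> (1/3)^N"
        using that by (intro power_decreasing) auto
      moreover have "norm (x m - x n) \<le> 3/2 * (1/3)^m"
        using tail'[of m n] that by (simp add: norm_minus_commute)
      ultimately show ?thesis
        using N unfolding dist_norm by linarith
    qed
    then show "\<exists>M. \<forall>m\<ge>M. \<forall>n>m. dist (x m) (x n) < e"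
      by blast
  qed
  then obtain L where L: "x \<longlonglongrightarrow> L"
    by (auto simp: Cauchy_convergent_iff convergent_def)
  have near: "norm (L - x n) \<le> 3/2 * (1/3)^n" for n
  proof (rule tendsto_upperbound)
    show "(\<lambda>m. norm (x m - x n)) \<longlonglongrightarrow> norm (L - x n)"
      by (intro tendsto_intros L)
    show "\<forall>\<^sub>F m in sequentially. norm (x m - x n) \<le> 3/2 * (1/3)^n"
      using tail' by (auto simp: eventually_sequentially)
  qed simp
  have large: "(4/3)^n / 2 \<le> norm (ip L (w n))" for n
  proof -
    have "norm (ip (L - x (Suc n)) (w n)) \<le> norm (L - x (Suc n)) * norm (w n)"
      by (rule Cauchy_Schwarz)
    \<comment> \<open>\<open>near\<close> at \<open>Suc n\<close> gives
      \<open>3/2 * (1/3)^(n + 1)\<close>, half the factor in \<open>x_large\<close>, so half of that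
      lower bound survives in the limit.\<close>
    also have "\<dots> \<le> (1/2 * (1/3)^n) * norm (w n)"
      using near[of "Suc n"] by (intro mult_right_mono) auto
    finally have "(1/2 * (1/3)^n) * norm (w n) \<le> norm (ip L (w n))"
      using x_large[of n] norm_triangle_ineq2[of "ip (x (Suc n)) (w n)" "ip L (w n)"]
      by (simp add: ip_diff_left norm_minus_commute)
    moreover have "(1/2 * (1/3)^n) * 4^n \<le> (1/2 * (1/3)^n) * norm (w n)"
      using w_large[of n] by (intro mult_left_mono) auto
    ultimately show ?thesis
      by (simp add: power_divide)
  qed
  obtain B where "\<forall>v\<in>W. norm (ip L v) \<le> B"
    using assms by blast
  then have "(4/3)^n \<le> 2 * B" for n
    using large[of n] wW[of n] by fastforce
  moreover obtain n where "(4/3::real)^n > 2 * B"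
    using real_arch_pow[of "4/3" "2 * B"] by auto
  ultimately show False
    by (meson not_le)
qed

end

subsection \<open>Bounded operators and adjoints\<close>

lemma bounded_operatorsI:
  assumes "vector_space s1" and "vector_space s2"
    and "\<And>x y. A (x + y) = A x + A y" and "\<And>c x. A (s1 c x) = s2 c (A x)"
    and "\<And>x. norm (A x) \<le> C * norm x"
  shows "A \<in> bounded_operators s1 s2"
  using assms by (auto simp: bounded_operators_def Vector_Spaces.linear_iff)

lemma bounded_operators_add: "A \<in> bounded_operators s1 s2 \<Longrightarrow> A (x + y) = A x + A y"
  by (simp add: bounded_operators_def Vector_Spaces.linear_iff)

lemma bounded_operators_scale: "A \<in> bounded_operators s1 s2 \<Longrightarrow> A (s1 c x) = s2 c (A x)"
  by (simp add: bounded_operators_def Vector_Spaces.linear_iff)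

text \<open>The definition leaves the sign of the bound open; its absolute value serves as
  well.\<close>

lemma bounded_operators_bound:
  assumes "A \<in> bounded_operators s1 s2"
  obtains C where "C \<ge> 0" and "\<And>x. norm (A x) \<le> C * norm x"
proof -
  obtain C where C: "\<And>x. norm (A x) \<le> C * norm x"
    using assms by (auto simp: bounded_operators_def)
  have "norm (A x) \<le> \<bar>C\<bar> * norm x" for x
    using C[of x] mult_right_mono[OF abs_ge_self norm_ge_zero, of C x] by linarith
  then show thesis
    using that[of "\<bar>C\<bar>"] by simp
qed

lemma bounded_operators_additive: "A \<in> bounded_operators s1 s2 \<Longrightarrow> Modules.additive A"
  by (rule Modules.additive.intro) (rule bounded_operators_add)

lemmas bounded_operators_zero = Modules.additive.zero[OF bounded_operators_additive]
  and bounded_operators_diff = Modules.additive.diff[OF bounded_operators_additive]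
  and bounded_operators_sum = Modules.additive.sum[OF bounded_operators_additive]

lemma bounded_operators_comp:
  assumes "A \<in> bounded_operators s1 s2" and "B \<in> bounded_operators s2 s3"
  shows "(\<lambda>x. B (A x)) \<in> bounded_operators s1 s3"
proof -
  obtain C where C: "\<And>x. norm (A x) \<le> C * norm x"
    using assms(1) by (rule bounded_operators_bound) blast
  obtain D where D: "D \<ge> 0" "\<And>x. norm (B x) \<le> D * norm x"
    using assms(2) by (rule bounded_operators_bound) blast
  show ?thesis
  proof (rule bounded_operatorsI)
    show "norm (B (A x)) \<le> (D * C) * norm x" for x
      using D(2)[of "A x"] mult_left_mono[OF C[of x] D(1)] by (simp add: mult.assoc)
    show "vector_space s1" "vector_space s3"
      using assms by (simp_all add: bounded_operators_def Vector_Spaces.linear_iff)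
  qed (simp_all add: bounded_operators_add[OF assms(1)] bounded_operators_add[OF assms(2)]
      bounded_operators_scale[OF assms(1)] bounded_operators_scale[OF assms(2)])
qed

text \<open>A member of the family supplies the facts that \<open>s1\<close> and \<open>s2\<close>
  are vector spaces, hence the nonempty index set.\<close>

lemma bounded_operators_sum_fun:
  assumes "I \<noteq> {}" and A: "\<And>i. i \<in> I \<Longrightarrow> A i \<in> bounded_operators s1 s2"
  shows "(\<lambda>x. \<Sum>i\<in>I. A i x) \<in> bounded_operators s1 s2"
proof -
  obtain i where "i \<in> I"
    using assms(1) by blast
  then have vs: "vector_space s1" "vector_space s2"
    using A[of i] by (simp_all add: bounded_operators_def Vector_Spaces.linear_iff)
  interpret V2: vector_space s2
    by (fact vs(2))
  have "\<forall>i\<in>I. \<exists>C. \<forall>x. norm (A i x) \<le> C * norm x"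
    using A by (simp add: bounded_operators_def)
  then obtain C where C: "\<And>i x. i \<in> I \<Longrightarrow> norm (A i x) \<le> C i * norm x"
    by metis
  show ?thesis
  proof (rule bounded_operatorsI[OF vs])
    show "(\<Sum>i\<in>I. A i (x + y)) = (\<Sum>i\<in>I. A i x) + (\<Sum>i\<in>I. A i y)" for x y
      using bounded_operators_add[OF A] by (simp add: sum.distrib)
    show "(\<Sum>i\<in>I. A i (s1 c x)) = s2 c (\<Sum>i\<in>I. A i x)" for c x
      using bounded_operators_scale[OF A] by (simp add: V2.scale_sum_right)
    show "norm (\<Sum>i\<in>I. A i x) \<le> (\<Sum>i\<in>I. C i) * norm x" for x
      unfolding sum_distrib_right by (rule sum_norm_le) (rule C)
  qed
qed

text \<open>Later proofs interpret this again with the spaces swapped or equal, to treat adjoints of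
  \<open>pinv\<close>, \<open>A \<circ> X\<close> and \<open>X \<circ> A\<close>.\<close>

locale hilbert_space_pair = H1: hilbert_space s1 ip1 + H2: hilbert_space s2 ip2
  for s1 :: "'f::real_or_complex_field \<Rightarrow> 'a::banach \<Rightarrow> 'a" and ip1 :: "'a \<Rightarrow> 'a \<Rightarrow> 'f"
    and s2 :: "'f \<Rightarrow> 'b::banach \<Rightarrow> 'b" and ip2 :: "'b \<Rightarrow> 'b \<Rightarrow> 'f"
begin

lemma bounded_linear_operator: "A \<in> bounded_operators s1 s2 \<Longrightarrow> bounded_linear A"
proof -
  assume A: "A \<in> bounded_operators s1 s2"
  obtain C where "\<And>x. norm (A x) \<le> C * norm x"
    using A by (rule bounded_operators_bound) blast
  then show ?thesis
    using bounded_operators_add[OF A] bounded_operators_scale[OF A, of "of_real _"]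
    unfolding H1.scale_of_real H2.scale_of_real
    by (intro bounded_linear_intro[where K = C]) (simp_all add: mult.commute)
qed

text \<open>Nondegeneracy of \<open>ip1\<close> makes the operator under \<open>THE\<close>
  unique.\<close>

lemma adjoint_op_eqI: "adjoint_op ip1 ip2 A = B" if "\<And>x y. ip2 (A x) y = ip1 x (B y)"
  unfolding adjoint_op_def
proof (rule the_equality)
  fix B' assume "\<forall>x y. ip2 (A x) y = ip1 x (B' y)"
  then have "ip1 x (B' y) = ip1 x (B y)" for x y
    using that by metis
  then show "B' = B"
    by (intro ext H1.ip_right_eqI)
qed (use that in blast)

text \<open>Riesz representation of \<open>\<lambda>x. ip2 (A x) y\<close>, for each
  \<open>y\<close>, provides the value of the adjoint at \<open>y\<close>.\<close>

lemma ip_adjoint_op: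
  assumes A: "A \<in> bounded_operators s1 s2"
  shows "ip1 x (adjoint_op ip1 ip2 A y) = ip2 (A x) y"
proof -
  obtain C where C: "\<And>x. norm (A x) \<le> C * norm x"
    using A by (rule bounded_operators_bound) blast
  have "\<exists>w. \<forall>x. ip2 (A x) y = ip1 x w" for y
  proof (rule H1.riesz_representation)
    show "norm (ip2 (A x) y) \<le> (C * norm y) * norm x" for x
      using H2.Cauchy_Schwarz[of "A x" y] mult_right_mono[OF C[of x] norm_ge_zero[of y]]
      by (simp add: ac_simps)
  qed (simp_all add: bounded_operators_add[OF A] bounded_operators_scale[OF A]
      H2.ip_add_left H2.ip_scale_left)
  then obtain B where "\<And>x y. ip2 (A x) y = ip1 x (B y)"
    by metis
  then show ?thesis
    using adjoint_op_eqI by metis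
qed

lemma ip_adjoint_op_left:
  assumes A: "A \<in> bounded_operators s1 s2"
  shows "ip1 (adjoint_op ip1 ip2 A y) x = ip2 y (A x)"
  using ip_adjoint_op[OF A] by (metis H1.ip_commute H2.ip_commute)

text \<open>A bound for \<open>A\<close> also bounds the adjoint \<open>?B\<close>: test the adjoint
  identity at \<open>?B y\<close> and cancel one factor \<open>norm (?B y)\<close>.\<close>

lemma adjoint_op_bounded:
  assumes A: "A \<in> bounded_operators s1 s2"
  shows "adjoint_op ip1 ip2 A \<in> bounded_operators s2 s1"
proof -
  obtain C where C0: "C \<ge> 0" and C: "\<And>x. norm (A x) \<le> C * norm x"
    using A by (rule bounded_operators_bound) blast
  let ?B = "adjoint_op ip1 ip2 A"
  show ?thesis
  proof (rule bounded_operatorsI)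
    show "vector_space s1" "vector_space s2"
      by unfold_locales
    show "?B (x + y) = ?B x + ?B y" for x y
      by (rule H1.ip_right_eqI) (simp add: ip_adjoint_op[OF A] H1.ip_add_right H2.ip_add_right)
    show "?B (s2 c x) = s1 c (?B x)" for c x
      by (rule H1.ip_right_eqI) (simp add: ip_adjoint_op[OF A] H1.ip_scale_right H2.ip_scale_right)
    show "norm (?B y) \<le> C * norm y" for y
    proof (cases "?B y = 0")
      case True
      then show ?thesis
        using C0 by simp
    next
      case False
      have "norm (?B y) * norm (?B y) = norm (ip2 (A (?B y)) y)"
        by (simp add: ip_adjoint_op[OF A, symmetric] H1.norm_ip_self power2_eq_square)
      also have "\<dots> \<le> norm (A (?B y)) * norm y"
        by (rule H2.Cauchy_Schwarz)
      also have "\<dots> \<le> (C * norm (?B y)) * norm y"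
        by (intro mult_right_mono C) simp
      finally show ?thesis
        using False by (simp add: ac_simps)
    qed
  qed
qed

lemma subspace_range:
  assumes A: "A \<in> bounded_operators s1 s2"
  shows "H2.subspace (range A)"
proof (rule H2.subspaceI)
  show "0 \<in> range A"
    using bounded_operators_zero[OF A] by (metis rangeI)
  show "x + y \<in> range A" if "x \<in> range A" "y \<in> range A" for x y
    using that by (auto simp: bounded_operators_add[OF A, symmetric])
  show "s2 c x \<in> range A" if "x \<in> range A" for c x
    using that by (auto simp: bounded_operators_scale[OF A, symmetric])
qed

end

subsection \<open>Moore--Penrose inverses of operators with closed range\<close>

locale closed_range_operator = hilbert_space_pair s1 ip1 s2 ip2
  for s1 :: "'f::real_or_complex_field \<Rightarrow> 'a::banach \<Rightarrow> 'a" and ip1 :: "'a \<Rightarrow> 'a \<Rightarrow> 'f"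
    and s2 :: "'f \<Rightarrow> 'b::banach \<Rightarrow> 'b" and ip2 :: "'b \<Rightarrow> 'b \<Rightarrow> 'f" +
  fixes A :: "'a \<Rightarrow> 'b"
  assumes closed_range_operator: "A \<in> closed_range_operators s1 s2"
begin

abbreviation "adj \<equiv> adjoint_op ip1 ip2 A"

lemma bounded: "A \<in> bounded_operators s1 s2"
  using closed_range_operator by (simp add: closed_range_operators_def)

lemma closed_range: "closed (range A)"
  using closed_range_operator by (simp add: closed_range_operators_def)

lemmas add = bounded_operators_add[OF bounded]
  and scale = bounded_operators_scale[OF bounded]
  and zero = bounded_operators_zero[OF bounded]
  and diff = bounded_operators_diff[OF bounded]

lemma adj_bounded: "adj \<in> bounded_operators s2 s1"
  by (rule adjoint_op_bounded[OF bounded])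

lemmas ip_adj = ip_adjoint_op[OF bounded]
  and ip_adj_left = ip_adjoint_op_left[OF bounded]
  and adj_diff = bounded_operators_diff[OF adj_bounded]
  and adj_scale = bounded_operators_scale[OF adj_bounded]

section \<open>Consequences of the closed range for an operator and its adjoint\<close>

lemma range_decomposition:
  obtains x where "\<And>z. ip2 (y - A x) (A z) = 0"
  using H2.orthogonal_projection_exists[OF subspace_range[OF bounded] closed_range, of y] by auto

text \<open>The set \<open>{w \<in> range A. norm (A\<^sup>* w) \<le> 1}\<close> is weakly bounded because
  \<open>ip (A x) w = ip x (A\<^sup>* w)\<close>, so uniform boundedness replaces the open mapping theorem.\<close>

lemma adj_bounded_below:
  obtains C where "C > 0" and "\<And>w. w \<in> range A \<Longrightarrow> norm w \<le> C * norm (adj w)"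
proof -
  let ?W = "{w \<in> range A. norm (adj w) \<le> 1}"
  have "\<exists>B. \<forall>w\<in>?W. norm (ip2 y w) \<le> B" for y
  proof -
    obtain x where x: "\<And>z. ip2 (y - A x) (A z) = 0"
      using range_decomposition by blast
    have "norm (ip2 y w) \<le> norm x" if w: "w \<in> ?W" for w
    proof -
      have "ip2 (y - A x) w = 0"
        using w x by blast
      then have "ip2 y w = ip1 x (adj w)"
        by (simp add: ip_adj H2.ip_diff_left)
      then have "norm (ip2 y w) \<le> norm x * norm (adj w)"
        using H1.Cauchy_Schwarz by simp
      also have "\<dots> \<le> norm x * 1"
        using w by (intro mult_left_mono) auto
      finally show ?thesis
        by simp
    qed
    then show ?thesis
      by blast
  qed
  then obtain C where C: "\<And>w. w \<in> ?W \<Longrightarrow> norm w \<le> C"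
    using H2.weakly_bounded_imp_bounded[of ?W] by blast
  \<comment> \<open>The added 1 makes the constant strictly positive. For
    \<open>adj w \<noteq> 0\<close>, rescaling \<open>w\<close> brings it into
    \<open>?W\<close>.\<close>
  have "norm w \<le> (\<bar>C\<bar> + 1) * norm (adj w)" if w: "w \<in> range A" for w
  proof (cases "adj w = 0")
    case True
    obtain x where "w = A x"
      using w by blast
    then have "ip2 w w = ip1 x (adj w)"
      by (simp add: ip_adj)
    then show ?thesis
      using True by simp
  next
    case False
    define w' where "w' = s2 (of_real (1 / norm (adj w))) w"
    have "norm (adj w') \<le> 1"
      using False by (simp add: w'_def adj_scale H1.norm_scale norm_divide)
    moreover have "w' \<in> range A"
      unfolding w'_def using subspace_range[OF bounded] w by (rule H2.subspace_scale)
    ultimately have "norm w' \<le> C"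
      by (intro C) blast
    then have "norm w \<le> C * norm (adj w)"
      using False by (simp add: w'_def H2.norm_scale norm_divide field_simps)
    also have "\<dots> \<le> (\<bar>C\<bar> + 1) * norm (adj w)"
      by (intro mult_right_mono) auto
    finally show ?thesis .
  qed
  then show thesis
    using that[of "\<bar>C\<bar> + 1"] by simp
qed

text \<open>The part of \<open>y\<close> orthogonal to the range of \<open>A\<close> is killed by
  \<open>adj\<close>.\<close>

lemma range_adj_eq: "range adj = adj ` range A"
proof (intro equalityI subsetI)
  fix u assume "u \<in> range adj"
  then obtain y where y: "u = adj y"
    by blast
  obtain x where x: "\<And>z. ip2 (y - A x) (A z) = 0"
    using range_decomposition by blast
  have "adj (y - A x) = 0"
    using x by (intro H1.ip_left_eqI) (simp add: ip_adj_left)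
  then show "u \<in> adj ` range A"
    by (simp add: y adj_diff)
qed blast

text \<open>On the complete subspace \<open>range A\<close> the map \<open>adj\<close> is bounded
  below, so its image there is complete, and that image is all of \<open>range adj\<close>.\<close>

lemma closed_range_adj: "closed (range adj)"
proof -
  interpret R: hilbert_space_pair s2 ip2 s1 ip1
    by unfold_locales
  obtain C where C: "C > 0" "\<And>w. w \<in> range A \<Longrightarrow> norm w \<le> C * norm (adj w)"
    using adj_bounded_below by blast
  have "complete (adj ` range A)"
  proof (rule complete_isometric_image)
    show "1 / C > 0"
      using C by simp
    show "\<forall>w\<in>range A. 1 / C * norm w \<le> norm (adj w)"
      using C by (simp add: field_simps)
    show "bounded_linear adj"
      by (rule R.bounded_linear_operator[OF adj_bounded])
    show "Real_Vector_Spaces.subspace (range A)"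
      using bounded_linear.linear[OF bounded_linear_operator[OF bounded]]
      by (rule linear_subspace_image) simp
    show "complete (range A)"
      using closed_range by (simp add: complete_eq_closed)
  qed
  then show ?thesis
    by (simp add: range_adj_eq complete_eq_closed)
qed

text \<open>Take \<open>u\<close> to be the projection of \<open>x\<close> onto
  \<open>range adj\<close>; the residual is orthogonal to that range and so lies in the kernel of
  \<open>A\<close>.\<close>

lemma adj_decomposition:
  obtains u where "u \<in> range adj" and "A u = A x"
proof -
  interpret R: hilbert_space_pair s2 ip2 s1 ip1
    by unfold_locales
  obtain u where u: "u \<in> range adj" "\<And>m. m \<in> range adj \<Longrightarrow> ip1 (x - u) m = 0"
    using H1.orthogonal_projection_exists[OF R.subspace_range[OF adj_bounded] closed_range_adj, of x]
    by auto
  have "ip2 (A (x - u)) z = 0" for z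
    using u(2)[of "adj z"] by (simp add: ip_adj)
  then have "A (x - u) = 0"
    using H2.ip_self_eq_zero by blast
  then show thesis
    using that u(1) by (simp add: diff)
qed

text \<open>Writing \<open>u = adj w\<close> with \<open>w\<close> in the range of \<open>A\<close>,
  the square of \<open>norm u\<close> is \<open>norm (ip2 (A u) w)\<close>, and
  \<open>norm w\<close> is controlled by \<open>norm u\<close>.\<close>

lemma bounded_below:
  obtains C where "C > 0" and "\<And>u. u \<in> range adj \<Longrightarrow> norm u \<le> C * norm (A u)"
proof -
  obtain C where C: "C > 0" "\<And>w. w \<in> range A \<Longrightarrow> norm w \<le> C * norm (adj w)"
    using adj_bounded_below by blast
  have "norm u \<le> C * norm (A u)" if u: "u \<in> range adj" for u
  proof (cases "u = 0")
    case False
    obtain w where w: "w \<in> range A" "u = adj w"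
      using u unfolding range_adj_eq by blast
    have "norm u * norm u = norm (ip2 (A u) w)"
      by (simp add: ip_adj[symmetric] w(2)[symmetric] H1.norm_ip_self power2_eq_square)
    also have "\<dots> \<le> norm (A u) * norm w"
      by (rule H2.Cauchy_Schwarz)
    also have "\<dots> \<le> norm (A u) * (C * norm u)"
      using C(2)[OF w(1)] w(2) by (intro mult_left_mono) auto
    finally show ?thesis
      using False by (simp add: ac_simps)
  qed (simp add: zero)
  then show thesis
    using that C(1) by blast
qed

text \<open>The difference lies in \<open>range adj\<close> and in the kernel of \<open>A\<close>,
  hence is orthogonal to itself.\<close>

lemma inj_on_range_adj:
  assumes "u \<in> range adj" and "v \<in> range adj" and "A u = A v"
  shows "u = v"
proof -
  obtain w where w: "u - v = adj w"
    using assms(1,2) by (auto simp: adj_diff[symmetric])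
  have "ip1 (u - v) (adj w) = 0"
    by (simp add: ip_adj diff assms(3))
  then show ?thesis
    by (simp add: w[symmetric])
qed

section \<open>Existence and uniqueness for the Moore-Penrose equations\<close>

text \<open>This is the predicate under \<open>THE\<close> in \<open>moore_penrose\<close>, named so
  that existence and uniqueness can be shown separately.\<close>

definition is_moore_penrose :: "('b \<Rightarrow> 'a) \<Rightarrow> bool" where
  "is_moore_penrose X \<longleftrightarrow> X \<in> closed_range_operators s2 s1 \<and>
     A \<circ> X \<circ> A = A \<and> X \<circ> A \<circ> X = X \<and>
     adjoint_op ip2 ip2 (A \<circ> X) = A \<circ> X \<and> adjoint_op ip1 ip1 (X \<circ> A) = X \<circ> A"

lemma is_moore_penrose_exists: "\<exists>X. is_moore_penrose X"
proof -
  have "\<exists>u\<in>range adj. \<forall>z. ip2 (y - A u) (A z) = 0" for y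
  proof -
    obtain x where x: "\<And>z. ip2 (y - A x) (A z) = 0"
      using range_decomposition[of y] by blast
    obtain u where "u \<in> range adj" "A u = A x"
      using adj_decomposition[of x] by blast
    then show ?thesis
      using x by (intro bexI[of _ u]) simp_all
  qed
  then obtain X where X_range: "\<And>y. X y \<in> range adj" and X_orth: "\<And>y z. ip2 (y - A (X y)) (A z) = 0"
    by metis
  \<comment> \<open>Linearity of \<open>X\<close> and \<open>X (A u) = u\<close> on
    \<open>range adj\<close> are read off from this characterisation.\<close>
  have X_eqI: "X y = u" if u: "u \<in> range adj" "\<And>z. ip2 (y - A u) (A z) = 0" for y u
  proof (rule inj_on_range_adj[OF X_range u(1)])
    have "ip2 (A (X y) - A u) (A z) = 0" for z
      using X_orth[of y z] u(2)[of z] by (simp add: H2.ip_diff_left)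
    then have "ip2 (A (X y) - A u) (A (X y) - A u) = 0"
      unfolding diff[symmetric] .
    then show "A (X y) = A u"
      by simp
  qed
  interpret R: hilbert_space_pair s2 ip2 s1 ip1
    by unfold_locales
  interpret H11: hilbert_space_pair s1 ip1 s1 ip1
    by unfold_locales
  interpret H22: hilbert_space_pair s2 ip2 s2 ip2
    by unfold_locales
  note sub = R.subspace_range[OF adj_bounded]
  have X_add: "X (x + y) = X x + X y" for x y
  proof (rule X_eqI)
    show "ip2 (x + y - A (X x + X y)) (A z) = 0" for z
      using X_orth[of x z] X_orth[of y z] by (simp add: add H2.ip_add_left H2.ip_diff_left)
  qed (intro H1.subspace_add sub X_range)
  have X_scale: "X (s2 c y) = s1 c (X y)" for c y
  proof (rule X_eqI)
    show "ip2 (s2 c y - A (s1 c (X y))) (A z) = 0" for z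
      using X_orth[of y z] by (simp add: scale H2.ip_scale_left H2.ip_diff_left)
  qed (intro H1.subspace_scale sub X_range)
  obtain C where C: "C > 0" "\<And>u. u \<in> range adj \<Longrightarrow> norm u \<le> C * norm (A u)"
    using bounded_below by blast
  have X_bound: "norm (X y) \<le> C * norm y" for y
  proof -
    have "(norm (y - A (X y) + A (X y)))\<^sup>2 = (norm (y - A (X y)))\<^sup>2 + (norm (A (X y)))\<^sup>2"
      by (rule H2.pythagoras) (rule X_orth)
    then have "(norm (A (X y)))\<^sup>2 \<le> (norm y)\<^sup>2"
      by simp
    then have "norm (A (X y)) \<le> norm y"
      by (simp add: abs_le_square_iff[symmetric])
    then have "C * norm (A (X y)) \<le> C * norm y"
      using C(1) by simp
    then show ?thesis
      using C(2)[OF X_range[of y]] by linarith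
  qed
  have X_adj: "X (A u) = u" if "u \<in> range adj" for u
    by (rule X_eqI[OF that]) simp
  have AXA: "A (X (A x)) = A x" for x
  proof -
    have "ip2 (A x - A (X (A x))) (A (x - X (A x))) = 0"
      by (rule X_orth)
    then show ?thesis
      by (simp add: diff)
  qed
  have "range X = range adj"
  proof (intro equalityI subsetI)
    fix u assume "u \<in> range adj"
    then have "u = X (A u)"
      by (rule X_adj[symmetric])
    then show "u \<in> range X"
      by (rule range_eqI)
  next
    fix u assume "u \<in> range X"
    then show "u \<in> range adj"
      using X_range by blast
  qed
  then have closed_X: "closed (range X)"
    using closed_range_adj by simp
  \<comment> \<open>\<open>A (X v)\<close> is the projection of \<open>v\<close> onto the range of
    \<open>A\<close>, which contains \<open>A (X u)\<close>. The right-hand side is Hermitian in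
    \<open>u\<close> and \<open>v\<close>, so \<open>A \<circ> X\<close> is self-adjoint.\<close>
  have AX_left: "ip2 (A (X u)) v = ip2 (A (X u)) (A (X v))" for u v
    using X_orth[of v "X u"] H2.ip_eq_zero_commute[of "v - A (X v)" "A (X u)"]
    by (simp add: H2.ip_diff_right)
  \<comment> \<open>With \<open>X (A u) = adj w\<close>, both sides equal
    \<open>ip2 w (A v)\<close>.\<close>
  have XA_left: "ip1 (X (A u)) v = ip1 (X (A u)) (X (A v))" for u v
  proof -
    obtain w where "X (A u) = adj w"
      using X_range by blast
    then show ?thesis
      by (simp add: ip_adj_left AXA)
  qed
  have "is_moore_penrose X"
    unfolding is_moore_penrose_def
  proof (intro conjI)
    show "X \<in> closed_range_operators s2 s1"
      unfolding closed_range_operators_def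
      using bounded_operatorsI[of s2 s1 X, OF H2.vector_space_axioms H1.vector_space_axioms X_add X_scale X_bound]
        closed_X by simp
    show "A \<circ> X \<circ> A = A"
      by (auto simp: AXA)
    show "X \<circ> A \<circ> X = X"
      using X_adj[OF X_range] by auto
    show "adjoint_op ip2 ip2 (A \<circ> X) = A \<circ> X"
    proof (rule H22.adjoint_op_eqI)
      fix u v
      have "ip2 (A (X u)) v = ip2 (A (X u)) (A (X v))"
        by (rule AX_left)
      also have "\<dots> = conjugate (ip2 (A (X v)) (A (X u)))"
        by (rule H2.ip_commute)
      also have "\<dots> = conjugate (ip2 (A (X v)) u)"
        by (rule arg_cong[OF AX_left[symmetric]])
      also have "\<dots> = ip2 u (A (X v))"
        by (rule H2.ip_commute[symmetric])
      finally show "ip2 ((A \<circ> X) u) v = ip2 u ((A \<circ> X) v)"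
        by simp
    qed
    show "adjoint_op ip1 ip1 (X \<circ> A) = X \<circ> A"
    proof (rule H11.adjoint_op_eqI)
      fix u v
      have "ip1 (X (A u)) v = ip1 (X (A u)) (X (A v))"
        by (rule XA_left)
      also have "\<dots> = conjugate (ip1 (X (A v)) (X (A u)))"
        by (rule H1.ip_commute)
      also have "\<dots> = conjugate (ip1 (X (A v)) u)"
        by (rule arg_cong[OF XA_left[symmetric]])
      also have "\<dots> = ip1 u (X (A v))"
        by (rule H1.ip_commute[symmetric])
      finally show "ip1 ((X \<circ> A) u) v = ip1 u ((X \<circ> A) v)"
        by simp
    qed
  qed
  then show ?thesis
    by blast
qed

lemma is_moore_penroseD:
  assumes "is_moore_penrose X"
  shows "X \<in> bounded_operators s2 s1" and "A (X (A x)) = A x" and "X (A (X y)) = X y"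
    and "ip2 (A (X u)) v = ip2 u (A (X v))" and "ip1 (X (A a)) b = ip1 a (X (A b))"
proof -
  interpret H11: hilbert_space_pair s1 ip1 s1 ip1
    by unfold_locales
  interpret H22: hilbert_space_pair s2 ip2 s2 ip2
    by unfold_locales
  show X: "X \<in> bounded_operators s2 s1"
    using assms by (simp add: is_moore_penrose_def closed_range_operators_def)
  show "A (X (A x)) = A x" "X (A (X y)) = X y"
    using assms unfolding is_moore_penrose_def by (metis comp_apply)+
  have AX: "A \<circ> X \<in> bounded_operators s2 s2"
    unfolding comp_def by (rule bounded_operators_comp[OF X bounded])
  have XA: "X \<circ> A \<in> bounded_operators s1 s1"
    unfolding comp_def by (rule bounded_operators_comp[OF bounded X])
  show "ip2 (A (X u)) v = ip2 u (A (X v))"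
    using H22.ip_adjoint_op[OF AX, of u v] assms by (simp add: is_moore_penrose_def)
  show "ip1 (X (A a)) b = ip1 a (X (A b))"
    using H11.ip_adjoint_op[OF XA, of a b] assms by (simp add: is_moore_penrose_def)
qed

text \<open>Self-adjointness gives \<open>A X = A Z A X = A Z\<close> and likewise
  \<open>X A = Z A\<close>; then \<open>X = X A X = Z A Z = Z\<close>.\<close>

lemma is_moore_penrose_unique:
  assumes "is_moore_penrose X" and "is_moore_penrose Z"
  shows "X = Z"
proof
  fix y
  note X = is_moore_penroseD[OF assms(1)] and Z = is_moore_penroseD[OF assms(2)]
  have "ip2 (A (X u)) v = ip2 (A (Z u)) v" for u v
  proof -
    have "ip2 (A (X u)) v = ip2 (A (Z (A (X u)))) v"
      by (simp only: Z(2))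
    also have "\<dots> = ip2 u (A (X (A (Z v))))"
      by (simp only: X(4) Z(4))
    also have "\<dots> = ip2 (A (Z u)) v"
      by (simp only: X(2) Z(4))
    finally show ?thesis .
  qed
  then have AX: "A (X u) = A (Z u)" for u
    by (rule H2.ip_left_eqI)
  have "ip1 (X (A u)) v = ip1 (Z (A u)) v" for u v
  proof -
    have "ip1 (X (A u)) v = ip1 (X (A (Z (A u)))) v"
      by (simp only: Z(2))
    also have "\<dots> = ip1 u (Z (A (X (A v))))"
      by (simp only: X(5) Z(5))
    also have "\<dots> = ip1 (Z (A u)) v"
      by (simp only: X(2) Z(5))
    finally show ?thesis .
  qed
  then have XA: "X (A u) = Z (A u)" for u
    by (rule H1.ip_left_eqI)
  have "X y = X (A (X y))"
    by (simp only: X(3))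
  also have "\<dots> = Z (A (Z y))"
    by (simp only: XA AX)
  also have "\<dots> = Z y"
    by (simp only: Z(3))
  finally show "X y = Z y" .
qed

abbreviation "pinv \<equiv> moore_penrose s1 ip1 s2 ip2 A"

lemma is_moore_penrose_pinv: "is_moore_penrose pinv"
proof -
  have "\<exists>!X. is_moore_penrose X"
    using is_moore_penrose_exists is_moore_penrose_unique by blast
  then show ?thesis
    unfolding moore_penrose_def is_moore_penrose_def by (rule theI')
qed

lemmas pinv_bounded = is_moore_penroseD(1)[OF is_moore_penrose_pinv]
  and A_pinv_A = is_moore_penroseD(2)[OF is_moore_penrose_pinv]
  and pinv_A_pinv = is_moore_penroseD(3)[OF is_moore_penrose_pinv]
  and ip_A_pinv = is_moore_penroseD(4)[OF is_moore_penrose_pinv]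
  and ip_pinv_A = is_moore_penroseD(5)[OF is_moore_penrose_pinv]

section \<open>Identities between the adjoint and the Moore-Penrose inverse\<close>

text \<open>This is the normal equation, the adjoint of
  \<open>A \<circ> pinv \<circ> A = A\<close>.\<close>

lemma adj_A_pinv: "adj (A (pinv y)) = adj y"
  by (rule H1.ip_right_eqI) (simp add: ip_adj ip_A_pinv[symmetric] A_pinv_A)

abbreviation "pinv_adj \<equiv> adjoint_op ip2 ip1 pinv"

lemma pinv_adj_bounded: "pinv_adj \<in> bounded_operators s1 s2"
proof -
  interpret R: hilbert_space_pair s2 ip2 s1 ip1
    by unfold_locales
  show ?thesis
    by (rule R.adjoint_op_bounded[OF pinv_bounded])
qed

text \<open>The left-hand side is the adjoint of \<open>pinv \<circ> A\<close>, which is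
  self-adjoint.\<close>

lemma adj_pinv_adj: "adj (pinv_adj x) = pinv (A x)"
proof -
  interpret R: hilbert_space_pair s2 ip2 s1 ip1
    by unfold_locales
  show ?thesis
    by (rule H1.ip_right_eqI) (simp add: ip_adj R.ip_adjoint_op[OF pinv_bounded] ip_pinv_A)
qed

lemma range_pinv: "range pinv \<subseteq> range adj"
proof
  fix u assume "u \<in> range pinv"
  then obtain y where "u = pinv (A (pinv y))"
    by (auto simp: pinv_A_pinv)
  then show "u \<in> range adj"
    by (metis adj_pinv_adj rangeI)
qed

end

subsection \<open>Sums of mutually orthogonal operators\<close>

theorem corollary2p4:
  fixes s1 :: "'f::real_or_complex_field \<Rightarrow> 'a::banach \<Rightarrow> 'a" and ip1 :: "'a \<Rightarrow> 'a \<Rightarrow> 'f"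
    and s2 :: "'f \<Rightarrow> 'b::banach \<Rightarrow> 'b" and ip2 :: "'b \<Rightarrow> 'b \<Rightarrow> 'f"
    and A :: "nat \<Rightarrow> 'a \<Rightarrow> 'b" and K k0 :: nat
  assumes H1: "hilbert_space s1 ip1" and H2: "hilbert_space s2 ip2"
    and K: "K \<ge> 1"
    and A: "\<And>k. k \<in> {1..K} \<Longrightarrow> A k \<in> closed_range_operators s1 s2"
    and range_A: "\<And>k k'. k \<in> {1..K} \<Longrightarrow> k' \<in> {1..K} \<Longrightarrow> k \<noteq> k' \<Longrightarrow>
      range (A k) \<subseteq> null_space (adjoint_op ip1 ip2 (A k'))"
    and range_adjoint: "\<And>k k'. k \<in> {1..K} \<Longrightarrow> k' \<in> {1..K} \<Longrightarrow> k \<noteq> k' \<Longrightarrow>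
      range (adjoint_op ip1 ip2 (A k)) \<subseteq> null_space (A k')"
    and k0: "k0 \<in> {1..K}"
    and inj_sum: "inj (\<lambda>x. \<Sum>k=1..K. A k x)"
  shows "invertible_operator s1 (\<lambda>x. \<Sum>k=1..K. adjoint_op ip1 ip2 (A k) (A k x)) \<and>
    moore_penrose s1 ip1 s2 ip2 (A k0) \<in> bounded_operators s2 s1 \<and>
    (\<forall>X \<in> bounded_operators s2 s1.
       (\<lambda>x. \<Sum>k=1..K. adjoint_op ip1 ip2 (A k) (A k x)) \<circ> X = adjoint_op ip1 ip2 (A k0)
         \<longleftrightarrow> X = moore_penrose s1 ip1 s2 ip2 (A k0))"
proof -
  interpret hilbert_space_pair s1 ip1 s2 ip2
    using H1 H2 by (rule hilbert_space_pair.intro)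
  let ?I = "{1..K}"
  have op: "closed_range_operator s1 ip1 s2 ip2 (A k)" if "k \<in> ?I" for k
    by unfold_locales (rule A[OF that])
  note A_bounded = closed_range_operator.bounded[OF op]
    and A_sum = bounded_operators_sum[OF closed_range_operator.bounded[OF op]]
  define As where "As k = adjoint_op ip1 ip2 (A k)" for k
  define G where "G k = moore_penrose s1 ip1 s2 ip2 (A k)" for k
  define Gs where "Gs k = adjoint_op ip2 ip1 (G k)" for k
  define S where "S x = (\<Sum>k\<in>?I. As k (A k x))" for x
  define T where "T x = (\<Sum>k\<in>?I. G k (Gs k x))" for x
  have As_bounded: "As k \<in> bounded_operators s2 s1" if "k \<in> ?I" for k
    unfolding As_def by (rule closed_range_operator.adj_bounded[OF op[OF that]])
  have G_bounded: "G k \<in> bounded_operators s2 s1" if "k \<in> ?I" for k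
    unfolding G_def by (rule closed_range_operator.pinv_bounded[OF op[OF that]])
  have Gs_bounded: "Gs k \<in> bounded_operators s1 s2" if "k \<in> ?I" for k
    unfolding Gs_def G_def by (rule closed_range_operator.pinv_adj_bounded[OF op[OF that]])
  have I_ne: "?I \<noteq> {}"
    using K by simp
  have S_bounded: "S \<in> bounded_operators s1 s1"
    unfolding S_def[abs_def]
    by (intro bounded_operators_sum_fun I_ne bounded_operators_comp[OF A_bounded As_bounded])
  have T_bounded: "T \<in> bounded_operators s1 s1"
    unfolding T_def[abs_def]
    by (intro bounded_operators_sum_fun I_ne bounded_operators_comp[OF Gs_bounded G_bounded])
  \<comment> \<open>The range of \<open>G k\<close> lies in that of \<open>As k\<close>, which is
    contained in the null space of \<open>A j\<close>.\<close>
  have cross: "A j (G k y) = 0" if "j \<in> ?I" "k \<in> ?I" "k \<noteq> j" for j k y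
    using closed_range_operator.range_pinv[OF op[OF that(2)]] range_adjoint[OF that(2,1,3)]
    unfolding G_def null_space_def by blast
  have A_sum_G: "A j (\<Sum>k\<in>?I. G k (y k)) = A j (G j (y j))" if "j \<in> ?I" for j y
  proof -
    have "A j (\<Sum>k\<in>?I. G k (y k)) = (\<Sum>k\<in>?I. A j (G k (y k)))"
      by (rule A_sum[OF that])
    also have "\<dots> = (\<Sum>k\<in>?I. if k = j then A j (G j (y j)) else 0)"
      by (rule sum.cong) (use cross that in auto)
    finally show ?thesis
      using that by simp
  qed
  have sum_projections: "(\<Sum>k\<in>?I. G k (A k x)) = x" for x
  proof -
    have "A j (\<Sum>k\<in>?I. G k (A k x)) = A j x" if "j \<in> ?I" for j
      unfolding A_sum_G[OF that] unfolding G_def by (rule closed_range_operator.A_pinv_A[OF op[OF that]])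
    \<comment> \<open>Both sides have the same image under every \<open>A j\<close>, hence under the
      injective sum.\<close>
    then show ?thesis
      by (intro injD[OF inj_sum] sum.cong refl)
  qed
  have S_T: "S (T x) = x" for x
  proof -
    have "S (T x) = (\<Sum>j\<in>?I. As j (A j (G j (Gs j x))))"
      unfolding S_def T_def by (rule sum.cong) (simp_all only: A_sum_G)
    \<comment> \<open>\<open>As j\<close> absorbs \<open>A j\<close> after \<open>G j\<close>,
      leaving \<open>As j (Gs j x) = G j (A j x)\<close>; these terms sum to
      \<open>x\<close>.\<close>
    also have "\<dots> = (\<Sum>j\<in>?I. G j (A j x))"
      unfolding As_def G_def Gs_def
      by (intro sum.cong refl)
        (simp only: closed_range_operator.adj_A_pinv[OF op] closed_range_operator.adj_pinv_adj[OF op])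
    finally show ?thesis
      by (simp only: sum_projections)
  qed
  have S_inj: "x = 0" if "S x = 0" for x
  proof -
    \<comment> \<open>The quadratic form of \<open>S\<close> is a sum of squares, so
      \<open>S x = 0\<close> forces every \<open>A k x = 0\<close>, and injectivity of the sum
      applies.\<close>
    have "(of_real (\<Sum>k\<in>?I. (norm (A k x))\<^sup>2) :: 'f) = ip1 (S x) x"
      unfolding S_def H1.ip_sum_left of_real_sum As_def
      by (intro sum.cong refl) (simp only: ip_adjoint_op_left[OF A_bounded] H2.ip_self)
    then have "(\<Sum>k\<in>?I. (norm (A k x))\<^sup>2) = 0"
      unfolding that H1.ip_zero_left of_real_eq_0_iff .
    then have "A k x = 0" if "k \<in> ?I" for k
      using that by (subst (asm) sum_nonneg_eq_0_iff) auto
    then have "(\<Sum>k\<in>?I. A k x) = (\<Sum>k\<in>?I. A k 0)"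
      by (intro sum.cong refl) (simp only: bounded_operators_zero[OF A_bounded])
    then show ?thesis
      by (rule injD[OF inj_sum])
  qed
  \<comment> \<open>By \<open>S_T\<close>, \<open>S\<close> kills \<open>T (S x) - x\<close>, so the
    right inverse is also a left inverse.\<close>
  have T_S: "T (S x) = x" for x
    using S_inj[of "T (S x) - x"] by (simp add: bounded_operators_diff[OF S_bounded] S_T)
  \<comment> \<open>Terms with \<open>k \<noteq> k0\<close> vanish by \<open>cross\<close>; the
    remaining one is the normal equation for \<open>A k0\<close>.\<close>
  have S_G: "S (G k0 y) = As k0 y" for y
  proof -
    have "S (G k0 y) = (\<Sum>k\<in>?I. if k = k0 then As k0 y else 0)"
      unfolding S_def
    proof (rule sum.cong)
      fix k assume k: "k \<in> ?I"
      show "As k (A k (G k0 y)) = (if k = k0 then As k0 y else 0)"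
        using cross[OF k k0] bounded_operators_zero[OF As_bounded[OF k]]
          closed_range_operator.adj_A_pinv[OF op[OF k0]] by (simp add: As_def G_def)
    qed simp
    then show ?thesis
      using k0 by simp
  qed
  have "invertible_operator s1 S"
    unfolding invertible_operator_def
    by (intro conjI S_bounded bexI[of _ T] T_bounded) (simp_all add: fun_eq_iff S_T T_S)
  moreover have "S \<circ> X = As k0 \<longleftrightarrow> X = G k0" for X
  proof
    assume "S \<circ> X = As k0"
    then have "S (X y) = S (G k0 y)" for y
      by (metis S_G comp_apply)
    then show "X = G k0"
      by (metis T_S ext)
  qed (auto simp: S_G)
  ultimately show ?thesis
    using G_bounded[OF k0] unfolding S_def[abs_def] As_def G_def by blast
qed

end
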